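(* Let $\alpha$ be a non-negative random variable with continuous distribution function $F$ and finite expectation $\mathbb{E}\alpha<+\infty$, and consider the linear demand $D(p\mid\alpha)=(\alpha-p)_+$. Then, for $0<p<H$, the seller's first order condition $$p=-\frac{\mathbb{E}\left(D(p\mid\alpha)\right)}{\frac{d}{dp}\mathbb{E}\left(D(p\mid\alpha)\right)}$$ is equivalent to $$p=\mathrm{m}(p),$$ where $\mathrm{m}$ is the mean residual demand function of $\alpha$.
   Context: Notation: $x_+:=\max\{x,0\}$, $\bar F:=1-F$, $H:=\inf\{p\ge 0: F(p)=1\}\le+\infty$. The mean residual demand (MRD) function is $\mathrm{m}(p):=\mathbb{E}(\alpha-p\mid\alpha>p)=\frac{1}{\bar F(p)}\int_p^{+\infty}\bar F(u)\,du$ for $p<H$ and $\mathrm{m}(p):=0$ otherwise. *)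

theory Defs
  imports "HOL-Probability.Probability"
begin

definition linear_demand :: "real \<Rightarrow> real \<Rightarrow> real" where
  "linear_demand p a = max (a - p) 0"

definition expected_demand :: "'a measure \<Rightarrow> ('a \<Rightarrow> real) \<Rightarrow> real \<Rightarrow> real" where
  "expected_demand M \<alpha> p = (\<integral>\<omega>. linear_demand p (\<alpha> \<omega>) \<partial>M)"

definition dist_fun :: "'a measure \<Rightarrow> ('a \<Rightarrow> real) \<Rightarrow> real \<Rightarrow> real" where
  "dist_fun M \<alpha> = cdf (distr M borel \<alpha>)"

text \<open>The infimum is taken in the extended reals, so that it is \<open>\<infinity>\<close> when the set is empty.\<close>

definition support_sup :: "'a measure \<Rightarrow> ('a \<Rightarrow> real) \<Rightarrow> ereal" where
  "support_sup M \<alpha> = (INF p\<in>{p. 0 \<le> p \<and> dist_fun M \<alpha> p = 1}. ereal p)"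

text \<open>The conditional expectation given the event \<open>\<alpha> > p\<close> is the integral with respect to \<open>M\<close>
  conditioned on that event, which has positive probability when \<open>0 \<le> p < support_sup M \<alpha>\<close>.
  The integral formula for it is \<open>mean_residual_demand_eq_tail_integral\<close> below.\<close>

definition mean_residual_demand :: "'a measure \<Rightarrow> ('a \<Rightarrow> real) \<Rightarrow> real \<Rightarrow> real" where
  "mean_residual_demand M \<alpha> p =
     (if ereal p < support_sup M \<alpha>
      then \<integral>\<omega>. (\<alpha> \<omega> - p) \<partial>uniform_measure M {\<omega> \<in> space M. \<alpha> \<omega> > p}
      else 0)"

lemma (in prob_space) survival_eq_prob:
  assumes [measurable]: "\<alpha> \<in> borel_measurable M"
  shows "1 - dist_fun M \<alpha> u = prob {\<omega> \<in> space M. \<alpha> \<omega> > u}"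
proof -
  have "dist_fun M \<alpha> u = prob {\<omega> \<in> space M. \<alpha> \<omega> \<le> u}"
    unfolding dist_fun_def cdf_def by (subst measure_distr) (auto intro!: arg_cong[where f=prob])
  also have "1 - \<dots> = prob (space M - {\<omega> \<in> space M. \<alpha> \<omega> \<le> u})"
    by (subst prob_compl) auto
  also have "space M - {\<omega> \<in> space M. \<alpha> \<omega> \<le> u} = {\<omega> \<in> space M. \<alpha> \<omega> > u}"
    by auto
  finally show ?thesis .
qed

lemma (in prob_space) mean_residual_demand_eq_tail_integral:
  assumes [measurable]: "\<alpha> \<in> borel_measurable M" and int: "integrable M \<alpha>"
    and p: "0 \<le> p" "ereal p < support_sup M \<alpha>"
  shows "mean_residual_demand M \<alpha> p =
    1 / (1 - dist_fun M \<alpha> p) * (LBINT u:{p..}. 1 - dist_fun M \<alpha> u)"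
proof -
  define A where "A = {\<omega> \<in> space M. \<alpha> \<omega> > p}"
  have [measurable]: "A \<in> sets M" unfolding A_def by measurable
  have "dist_fun M \<alpha> p \<noteq> 1"
  proof
    assume "dist_fun M \<alpha> p = 1"
    then have "support_sup M \<alpha> \<le> ereal p"
      unfolding support_sup_def using p by (intro INF_lower) auto
    with p show False by simp
  qed
  then have pos: "prob A > 0"
    using survival_eq_prob[OF assms(1), of p] measure_nonneg[of M A] unfolding A_def by linarith
  have len: "(\<integral>u. indicator {p..<b} u \<partial>lborel) = max (b - p) 0" for b :: real
    by (cases "p \<le> b") auto
  have um: "uniform_measure M A = density M (\<lambda>\<omega>. ennreal (indicator A \<omega> / prob A))"
    unfolding uniform_measure_def emeasure_eq_measure using pos
    by (intro density_cong) (auto simp: divide_ennreal[of 1, simplified] split: split_indicator)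
  have "mean_residual_demand M \<alpha> p = (\<integral>\<omega>. indicator A \<omega> / prob A * (\<alpha> \<omega> - p) \<partial>M)"
    unfolding mean_residual_demand_def using p
    by (simp add: A_def[symmetric] um integral_real_density)
  also have "\<dots> = (\<integral>\<omega>. 1 / prob A * max (\<alpha> \<omega> - p) 0 \<partial>M)"
    by (intro Bochner_Integration.integral_cong) (auto simp: A_def split: split_indicator)
  also have "\<dots> = 1 / prob A * (\<integral>\<omega>. max (\<alpha> \<omega> - p) 0 \<partial>M)"
    by (rule Bochner_Integration.integral_mult_right_zero)
  also have "(\<integral>\<omega>. max (\<alpha> \<omega> - p) 0 \<partial>M)
      = (\<integral>\<omega>. (\<integral>u. indicator {p..<\<alpha> \<omega>} u \<partial>lborel) \<partial>M)"
    by (simp only: len)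
  also have "\<dots> = (\<integral>u. (\<integral>\<omega>. indicator {p..<\<alpha> \<omega>} u \<partial>M) \<partial>lborel)"
  proof -
    interpret P: pair_sigma_finite M lborel
      by unfold_locales
    have ind: "(\<lambda>x. indicator {p..<\<alpha> (fst x)} (snd x) :: real)
        = (\<lambda>x. if p \<le> snd x \<and> snd x < \<alpha> (fst x) then 1 else 0)"
      by (auto split: split_indicator)
    have eq: "(\<lambda>\<omega>. \<integral>u. norm (indicator {p..<\<alpha> \<omega>} u :: real) \<partial>lborel) = (\<lambda>\<omega>. max (\<alpha> \<omega> - p) 0)"
      by (simp only: len real_norm_def abs_indicator)
    have "integrable (M \<Otimes>\<^sub>M lborel) (\<lambda>x. indicator {p..<\<alpha> (fst x)} (snd x) :: real)"
    proof (rule P.Fubini_integrable)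
      show "(\<lambda>x. indicator {p..<\<alpha> (fst x)} (snd x) :: real) \<in> borel_measurable (M \<Otimes>\<^sub>M lborel)"
        unfolding ind by measurable
      show "integrable M (\<lambda>\<omega>. \<integral>u. norm (indicator {p..<\<alpha> (fst (\<omega>, u))} (snd (\<omega>, u)) :: real) \<partial>lborel)"
        using int by (simp only: fst_conv snd_conv eq) (intro integrable_max; simp)
      have "integrable lborel (indicat_real {p..<b})" for b
        by (cases "p \<le> b") (auto intro!: integrable_real_indicator)
      then show "AE \<omega> in M. integrable lborel
          (\<lambda>u. indicator {p..<\<alpha> (fst (\<omega>, u))} (snd (\<omega>, u)) :: real)"
        by simp
    qed
    then show ?thesis
      by (intro P.Fubini_integral[symmetric]) (simp add: case_prod_beta')
  qed
  also have "\<dots> = (LBINT u:{p..}. 1 - dist_fun M \<alpha> u)"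
    unfolding set_lebesgue_integral_def
  proof (intro Bochner_Integration.integral_cong refl)
    fix u :: real
    have "(\<integral>\<omega>. (indicator {p..<\<alpha> \<omega>} u :: real) \<partial>M)
        = (\<integral>\<omega>. indicator {p..} u * indicator {\<omega> \<in> space M. \<alpha> \<omega> > u} \<omega> \<partial>M)"
      by (intro Bochner_Integration.integral_cong) (auto split: split_indicator)
    also have "\<dots> = indicator {p..} u * prob {\<omega> \<in> space M. \<alpha> \<omega> > u}"
      by simp
    finally show "(\<integral>\<omega>. indicator {p..<\<alpha> \<omega>} u \<partial>M) = indicator {p..} u *\<^sub>R (1 - dist_fun M \<alpha> u)"
      by (simp add: survival_eq_prob)
  qed
  finally show ?thesis
    by (simp add: survival_eq_prob A_def)
qed

end

theory Submission
  imports Defs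
begin

text \<open>
  Write \<open>G p\<close> for the expected demand \<open>E (\<alpha> - p)\<^sub>+\<close> and \<open>S p = P (\<alpha> > p)\<close> for the survival
  function. For \<open>x \<le> y\<close> the loss of demand caused by raising the price from \<open>x\<close> to \<open>y\<close> lies, pointwise,
  between \<open>y - x\<close> on the event \<open>\<alpha> > y\<close> and \<open>y - x\<close> on the event \<open>\<alpha> > x\<close>. Taking expectations,
  the difference quotient of \<open>G\<close> between \<open>x\<close> and \<open>y\<close> lies between \<open>- S x\<close> and \<open>- S y\<close>
  (\<open>expected_demand_diff_bounds\<close>), so that \<open>G\<close> has derivative \<open>- S p\<close> wherever the distribution
  function is continuous (\<open>expected_demand_has_derivative\<close>).

  On the other hand \<open>\<alpha> - p\<close> agrees with \<open>(\<alpha> - p)\<^sub>+\<close> on the event \<open>\<alpha> > p\<close>, and the latter vanishes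
  off this event, hence \<open>m p = G p / S p\<close> (\<open>mean_residual_demand_eq_ratio\<close>). The right-hand side of
  the first order condition is therefore \<open>m p\<close> itself.
\<close>

context prob_space
begin

lemma integrable_linear_demand:
  assumes "integrable M \<alpha>"
  shows "integrable M (\<lambda>\<omega>. linear_demand p (\<alpha> \<omega>))"
  unfolding linear_demand_def using assms by (intro integrable_max) auto

lemma expected_demand_diff_bounds:
  assumes [measurable]: "\<alpha> \<in> borel_measurable M" and int: "integrable M \<alpha>" and "x \<le> y"
  shows "(y - x) * (1 - dist_fun M \<alpha> y) \<le> expected_demand M \<alpha> x - expected_demand M \<alpha> y"
    and "expected_demand M \<alpha> x - expected_demand M \<alpha> y \<le> (y - x) * (1 - dist_fun M \<alpha> x)"
proof -
  have ind: "integrable M (\<lambda>\<omega>. (y - x) * indicator {\<omega> \<in> space M. \<alpha> \<omega> > u} \<omega>)" for u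
    by (intro integrable_mult_right integrable_real_indicator) (auto simp: emeasure_eq_measure)
  have eq: "(y - x) * (1 - dist_fun M \<alpha> u)
      = (\<integral>\<omega>. (y - x) * indicator {\<omega> \<in> space M. \<alpha> \<omega> > u} \<omega> \<partial>M)" for u
    by (simp add: survival_eq_prob)
  note lin = integrable_linear_demand[OF int]
  have diff: "expected_demand M \<alpha> x - expected_demand M \<alpha> y
      = (\<integral>\<omega>. linear_demand x (\<alpha> \<omega>) - linear_demand y (\<alpha> \<omega>) \<partial>M)"
    unfolding expected_demand_def by (rule Bochner_Integration.integral_diff[OF lin lin, symmetric])
  note lin_diff = Bochner_Integration.integrable_diff[OF lin lin]
  show "(y - x) * (1 - dist_fun M \<alpha> y) \<le> expected_demand M \<alpha> x - expected_demand M \<alpha> y"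
    unfolding eq diff
    by (rule integral_mono[OF ind lin_diff])
      (use \<open>x \<le> y\<close> in \<open>auto simp: linear_demand_def split: split_indicator\<close>)
  show "expected_demand M \<alpha> x - expected_demand M \<alpha> y \<le> (y - x) * (1 - dist_fun M \<alpha> x)"
    unfolding eq diff
    by (rule integral_mono[OF lin_diff ind])
      (use \<open>x \<le> y\<close> in \<open>auto simp: linear_demand_def split: split_indicator\<close>)
qed

text \<open>By the previous bounds, the difference quotient at \<open>p\<close> differs from \<open>- S p\<close> by at most the
  increment of the distribution function.\<close>

lemma expected_demand_has_derivative:
  assumes "\<alpha> \<in> borel_measurable M" and "integrable M \<alpha>" and cont: "isCont (dist_fun M \<alpha>) p"
  shows "(expected_demand M \<alpha> has_real_derivative - (1 - dist_fun M \<alpha> p)) (at p)"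
proof -
  let ?F = "dist_fun M \<alpha>" and ?G = "expected_demand M \<alpha>"
  have bound: "\<bar>(?G y - ?G p) / (y - p) - - (1 - ?F p)\<bar> \<le> \<bar>?F y - ?F p\<bar>" if "y \<noteq> p" for y
  proof (cases "p < y")
    case True
    then have "1 - ?F y \<le> (?G p - ?G y) / (y - p)" "(?G p - ?G y) / (y - p) \<le> 1 - ?F p"
      using expected_demand_diff_bounds[OF assms(1,2), of p y]
      by (simp_all add: pos_le_divide_eq pos_divide_le_eq mult.commute)
    moreover have "(?G y - ?G p) / (y - p) = - ((?G p - ?G y) / (y - p))"
      by (simp add: minus_divide_left)
    ultimately show ?thesis
      by linarith
  next
    case False
    with that have "y < p" by simp
    then have "1 - ?F p \<le> (?G y - ?G p) / (p - y)" "(?G y - ?G p) / (p - y) \<le> 1 - ?F y"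
      using expected_demand_diff_bounds[OF assms(1,2), of y p]
      by (simp_all add: pos_le_divide_eq pos_divide_le_eq mult.commute)
    moreover have "(?G y - ?G p) / (y - p) = - ((?G y - ?G p) / (p - y))"
      by (simp add: minus_divide_right)
    ultimately show ?thesis
      by linarith
  qed
  have "((\<lambda>y. ?F y - ?F p) \<longlongrightarrow> 0) (at p)"
    using cont by (simp add: isCont_def LIM_zero)
  then have "((\<lambda>y. (?G y - ?G p) / (y - p) - - (1 - ?F p)) \<longlongrightarrow> 0) (at p)"
    by (rule Lim_transform_bound[rotated])
      (simp add: eventually_at_filter bound[simplified])
  then show ?thesis
    unfolding has_field_derivative_iff by (rule LIM_zero_cancel)
qed

lemma mean_residual_demand_eq_ratio:
  assumes [measurable]: "\<alpha> \<in> borel_measurable M"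
    and p: "0 \<le> p" "ereal p < support_sup M \<alpha>"
  shows "mean_residual_demand M \<alpha> p = expected_demand M \<alpha> p / (1 - dist_fun M \<alpha> p)"
proof -
  define A where "A = {\<omega> \<in> space M. \<alpha> \<omega> > p}"
  have [measurable]: "A \<in> sets M" unfolding A_def by measurable
  \<comment> \<open>\<open>A\<close> has positive probability, as \<open>p\<close> would otherwise bound \<open>support_sup M \<alpha>\<close> from above.\<close>
  have "dist_fun M \<alpha> p \<noteq> 1"
  proof
    assume "dist_fun M \<alpha> p = 1"
    then have "support_sup M \<alpha> \<le> ereal p"
      unfolding support_sup_def using p by (intro INF_lower) auto
    with p show False by simp
  qed
  then have pos: "prob A > 0"
    using survival_eq_prob[OF assms(1), of p] measure_nonneg[of M A] unfolding A_def by linarith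
  \<comment> \<open>Conditioning on \<open>A\<close> means integrating against the density \<open>indicator A / prob A\<close>.\<close>
  have um: "uniform_measure M A = density M (\<lambda>\<omega>. ennreal (indicator A \<omega> / prob A))"
    unfolding uniform_measure_def emeasure_eq_measure using pos
    by (intro density_cong) (auto simp: divide_ennreal[of 1, simplified] split: split_indicator)
  have "mean_residual_demand M \<alpha> p = (\<integral>\<omega>. indicator A \<omega> / prob A * (\<alpha> \<omega> - p) \<partial>M)"
    unfolding mean_residual_demand_def using p
    by (simp add: A_def[symmetric] um integral_real_density)
  also have "\<dots> = (\<integral>\<omega>. linear_demand p (\<alpha> \<omega>) / prob A \<partial>M)"
    by (intro Bochner_Integration.integral_cong)
      (auto simp: A_def linear_demand_def split: split_indicator)
  also have "\<dots> = expected_demand M \<alpha> p / prob A"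
    by (simp add: expected_demand_def)
  finally show ?thesis
    by (simp add: survival_eq_prob A_def)
qed

end

theorem lemma2p2:
  fixes M :: "'a measure" and \<alpha> :: "'a \<Rightarrow> real" and p :: real
  assumes "prob_space M"
    and "\<alpha> \<in> borel_measurable M"
    and "AE \<omega> in M. 0 \<le> \<alpha> \<omega>"
    and "continuous_on UNIV (dist_fun M \<alpha>)"
    and "integrable M \<alpha>"
    and "0 < p"
    and "ereal p < support_sup M \<alpha>"
  shows "p = - (expected_demand M \<alpha> p / deriv (expected_demand M \<alpha>) p)
         \<longleftrightarrow> p = mean_residual_demand M \<alpha> p"
proof -
  interpret prob_space M by fact
  have "isCont (dist_fun M \<alpha>) p"
    using assms(4) by (simp add: continuous_on_eq_continuous_at)
  then have "deriv (expected_demand M \<alpha>) p = - (1 - dist_fun M \<alpha> p)"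
    using expected_demand_has_derivative assms(2,5) by (intro DERIV_imp_deriv)
  then have "- (expected_demand M \<alpha> p / deriv (expected_demand M \<alpha>) p)
      = expected_demand M \<alpha> p / (1 - dist_fun M \<alpha> p)"
    by (simp only: divide_minus_right minus_minus)
  also have "\<dots> = mean_residual_demand M \<alpha> p"
    using mean_residual_demand_eq_ratio assms(2,6,7) by simp
  finally show ?thesis
    by simp
qed

end
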